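(* Let $c_0,c_h\in\mathbb{R}$ be constants and let $(T,\mathbf{J},\boldsymbol{\psi},\varphi)$ be a smooth solution on $\Omega\times[0,t_f]$ of $$\partial_t T+c_0\nabla\cdot\mathbf{J}=0,\qquad \partial_t\mathbf{J}+c_0\nabla T+c_h\nabla\times\boldsymbol{\psi}=-\tfrac1\tau\mathbf{J},$$ $$\partial_t\boldsymbol{\psi}-c_h\nabla\times\mathbf{J}+c_h\nabla\varphi=0,\qquad \partial_t\varphi+c_h\nabla\cdot\boldsymbol{\psi}=0.$$ Set $\boldsymbol{\omega}_{\mathbf{J}}=\nabla\times\mathbf{J}$, $\boldsymbol{\omega}_{\boldsymbol{\psi}}=\nabla\times\boldsymbol{\psi}$ and $e_{\boldsymbol{\omega}}=\frac12(\|\boldsymbol{\omega}_{\mathbf{J}}\|^2+\|\boldsymbol{\omega}_{\boldsymbol{\psi}}\|^2)$. Then $$\partial_t e_{\boldsymbol{\omega}}+\nabla\cdot\big(c_h\,\boldsymbol{\omega}_{\boldsymbol{\psi}}\times\boldsymbol{\omega}_{\mathbf{J}}\big)=-\frac1\tau\|\boldsymbol{\omega}_{\mathbf{J}}\|^2\le0.$$ As a result, if the boundary conditions are such that the boundary terms vanish, i.e. $\int_{\partial\Omega}c_h(\boldsymbol{\omega}_{\boldsymbol{\psi}}\times\boldsymbol{\omega}_{\mathbf{J}})\cdot\mathbf{n}\,\mathrm{d}S=0$ for all $t$, then the total rotational energy $\mathrm{E}_{\boldsymbol{\omega}}(t)=\int_\Omega e_{\boldsymbol{\omega}}(\mathbf{x},t)\,\mathrm{d}\Omega$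 satisfies $$\mathrm{E}_{\boldsymbol{\omega}}(t)-\mathrm{E}_{\boldsymbol{\omega}}(0)=-\frac1\tau\int_0^t\int_\Omega\|\boldsymbol{\omega}_{\mathbf{J}}(\mathbf{x},s)\|^2\,\mathrm{d}\Omega\,\mathrm{d}s\le0.$$ In particular: (a) for finite $\tau>0$, $\mathrm{E}_{\boldsymbol{\omega}}$ is non-increasing; (b) in the absence of relaxation ($1/\tau=0$), $\mathrm{E}_{\boldsymbol{\omega}}$ is conserved. As a consequence, for such boundary conditions the following involution holds: if $\nabla\times\mathbf{J}(\mathbf{x},0)=0$ and $\nabla\times\boldsymbol{\psi}(\mathbf{x},0)=0$, then $\nabla\times\mathbf{J}(\mathbf{x},t)=0$ and $\nabla\times\boldsymbol{\psi}(\mathbf{x},t)=0$ for all $t>0$.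
   Context: $\Omega\subset\mathbb{R}^3$ is a bounded domain on which the divergence theorem holds, with unit outward normal $\mathbf{n}$; $t_f>0$ and times $t$ range over the interval of existence $[0,t_f]$. The unknowns are $T,\varphi\in\mathbb{R}$ and $\mathbf{J},\boldsymbol{\psi}\in\mathbb{R}^3$, functions of $(\mathbf{x},t)$. The relaxation time is a constant $\tau\in(0,+\infty]$, with the convention that $1/\tau=0$ (i.e. $\tau=+\infty$) means the relaxation source term is absent. $\|\cdot\|$ is the Euclidean norm. *)

theory Defs
  imports "HOL-Analysis.Analysis"
begin

text \<open>
  Conventions. A field is a function of \<open>x\<close> in \<open>\<real>\<^sup>3\<close> and \<open>t\<close>, curried in this order.
  Spatial operators act on \<open>\<lambda>y. F y t\<close> with \<open>t\<close> fixed. Everything is evaluated inside the open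
  set \<open>\<Omega>\<close>; values on the boundary are limits from inside \<open>\<Omega>\<close>.
\<close>


subsection \<open>Differential operators\<close>

definition partial :: "3 \<Rightarrow> (real^3 \<Rightarrow> 'b::real_normed_vector) \<Rightarrow> real^3 \<Rightarrow> 'b" where
  "partial i F x = vector_derivative (\<lambda>h. F (x + h *\<^sub>R axis i 1)) (at 0)"

definition grad :: "(real^3 \<Rightarrow> real) \<Rightarrow> real^3 \<Rightarrow> real^3" where
  "grad f x = (\<chi> i. partial i f x)"

definition divergence :: "(real^3 \<Rightarrow> real^3) \<Rightarrow> real^3 \<Rightarrow> real" where
  "divergence F x = (\<Sum>i\<in>UNIV. partial i F x $ i)"

definition curl :: "(real^3 \<Rightarrow> real^3) \<Rightarrow> real^3 \<Rightarrow> real^3" where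
  "curl F x = vector [partial 2 F x $ 3 - partial 3 F x $ 2,
                      partial 3 F x $ 1 - partial 1 F x $ 3,
                      partial 1 F x $ 2 - partial 2 F x $ 1]"

text \<open>The time derivative is one-sided at the two ends of \<open>[0, tf]\<close>.\<close>

definition time_deriv ::
    "real \<Rightarrow> (real^3 \<Rightarrow> real \<Rightarrow> 'b::real_normed_vector) \<Rightarrow> real^3 \<Rightarrow> real \<Rightarrow> 'b" where
  "time_deriv tf F x t = vector_derivative (F x) (at t within {0..tf})"


subsection \<open>Smoothness up to the boundary\<close>

definition extends_continuously ::
    "('a::topological_space \<Rightarrow> 'b::topological_space) \<Rightarrow> 'a set \<Rightarrow> bool" where
  "extends_continuously f S \<longleftrightarrow> (\<exists>g. continuous_on (closure S) g \<and> (\<forall>x\<in>S. g x = f x))"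

text \<open>
  \<open>Ck_upto k f S\<close>: all derivatives of \<open>f\<close> of order at most \<open>k\<close> exist on \<open>S\<close> and extend
  continuously to the closure of \<open>S\<close>. It is used for \<open>S = \<Omega>\<close> and \<open>S = \<Omega> \<times> [0, tf]\<close> with
  \<open>\<Omega>\<close> open and \<open>tf > 0\<close>, where derivatives within \<open>S\<close> are unique.
\<close>

primrec Ck_upto ::
    "nat \<Rightarrow> ('a::real_normed_vector \<Rightarrow> 'b::real_normed_vector) \<Rightarrow> 'a set \<Rightarrow> bool" where
  "Ck_upto 0 f S \<longleftrightarrow> extends_continuously f S"
| "Ck_upto (Suc k) f S \<longleftrightarrow> extends_continuously f S \<and>
     (\<exists>f'. (\<forall>x\<in>S. (f has_derivative f' x) (at x within S)) \<and> (\<forall>v. Ck_upto k (\<lambda>x. f' x v) S))"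

definition smooth_upto ::
    "('a::real_normed_vector \<Rightarrow> 'b::real_normed_vector) \<Rightarrow> 'a set \<Rightarrow> bool" where
  "smooth_upto f S \<longleftrightarrow> (\<forall>k. Ck_upto k f S)"

definition boundary_value ::
    "(real^3) set \<Rightarrow> (real^3 \<Rightarrow> 'b::t2_space) \<Rightarrow> real^3 \<Rightarrow> 'b" where
  "boundary_value \<Omega> F x = Lim (at x within \<Omega>) F"


subsection \<open>Surface measure, outward normal and the divergence theorem\<close>

text \<open>
  The surface measure is the two-dimensional Hausdorff measure, with the factor \<open>\<pi>/4\<close> that makes
  it agree with area. The Hausdorff outer measure is countably additive on Borel sets
  (Caratheodory's criterion), so \<open>measure_of\<close> below does not fall back to the zero measure.
\<close>

definition hausdorff2_size :: "real \<Rightarrow> (real^3) set \<Rightarrow> ennreal" where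
  "hausdorff2_size \<delta> A =
     (INF U\<in>{U :: nat \<Rightarrow> (real^3) set.
                A \<subseteq> (\<Union>i. U i) \<and> (\<forall>i. bounded (U i) \<and> diameter (U i) \<le> \<delta>)}.
        \<Sum>i. ennreal (pi / 4 * (diameter (U i))\<^sup>2))"

definition hausdorff2_outer :: "(real^3) set \<Rightarrow> ennreal" where
  "hausdorff2_outer A = (SUP \<delta>\<in>{0<..}. hausdorff2_size \<delta> A)"

definition surface_measure :: "(real^3) measure" where
  "surface_measure = measure_of UNIV (sets borel) hausdorff2_outer"

text \<open>
  Federer's exterior normal: near \<open>x\<close>, up to volume of order \<open>o(r\<^sup>3)\<close>, the set \<open>\<Omega>\<close> is the
  half-space of directions with \<open>(y - x) \<bullet> u < 0\<close>. At a point with a tangent plane and \<open>\<Omega>\<close> on one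
  side only it is the classical outward normal.
\<close>

definition outward_unit_normal :: "(real^3) set \<Rightarrow> real^3 \<Rightarrow> real^3 \<Rightarrow> bool" where
  "outward_unit_normal \<Omega> x u \<longleftrightarrow> norm u = 1 \<and>
     ((\<lambda>r. measure lborel {y \<in> cball x r. (y - x) \<bullet> u > 0 \<and> y \<in> \<Omega>} / r ^ 3) \<longlongrightarrow> 0) (at_right 0) \<and>
     ((\<lambda>r. measure lborel {y \<in> cball x r. (y - x) \<bullet> u < 0 \<and> y \<notin> \<Omega>} / r ^ 3) \<longlongrightarrow> 0) (at_right 0)"

definition surface_flux :: "(real^3) set \<Rightarrow> (real^3 \<Rightarrow> real^3) \<Rightarrow> (real^3 \<Rightarrow> real^3) \<Rightarrow> real" where
  "surface_flux \<Omega> n F = (LINT x:frontier \<Omega>|surface_measure. boundary_value \<Omega> F x \<bullet> n x)"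

text \<open>
  The normal is only required almost everywhere, so that edges and corners are allowed.
  The integrability clause is needed since a non-integrable function has integral \<open>0\<close> by convention.
\<close>

definition divergence_theorem_holds :: "(real^3) set \<Rightarrow> (real^3 \<Rightarrow> real^3) \<Rightarrow> bool" where
  "divergence_theorem_holds \<Omega> n \<longleftrightarrow>
     (AE x\<in>frontier \<Omega> in surface_measure. outward_unit_normal \<Omega> x (n x)) \<and>
     (\<forall>F. Ck_upto 1 F \<Omega> \<longrightarrow>
        set_integrable surface_measure (frontier \<Omega>) (\<lambda>x. boundary_value \<Omega> F x \<bullet> n x) \<and>
        (LINT x:\<Omega>|lborel. divergence F x) = surface_flux \<Omega> n F)"

definition bounded_domain :: "(real^3) set \<Rightarrow> bool" where
  "bounded_domain \<Omega> \<longleftrightarrow> open \<Omega> \<and> connected \<Omega> \<and> \<Omega> \<noteq> {} \<and> bounded \<Omega>"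


subsection \<open>The system and the rotational energy\<close>

text \<open>\<open>1 / \<tau>\<close> for \<open>\<tau>\<close> in \<open>(0, \<infinity>]\<close>, which is \<open>0\<close> for \<open>\<tau> = \<infinity>\<close>.\<close>

definition relaxation_rate :: "ereal \<Rightarrow> real" where
  "relaxation_rate \<tau> = real_of_ereal (1 / \<tau>)"

definition smooth_solution ::
    "real \<Rightarrow> real \<Rightarrow> ereal \<Rightarrow> (real^3) set \<Rightarrow> real \<Rightarrow>
     (real^3 \<Rightarrow> real \<Rightarrow> real) \<Rightarrow> (real^3 \<Rightarrow> real \<Rightarrow> real^3) \<Rightarrow>
     (real^3 \<Rightarrow> real \<Rightarrow> real^3) \<Rightarrow> (real^3 \<Rightarrow> real \<Rightarrow> real) \<Rightarrow> bool" where
  "smooth_solution c0 ch \<tau> \<Omega> tf T J \<psi> \<phi> \<longleftrightarrow>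
     smooth_upto (\<lambda>(x, t). T x t) (\<Omega> \<times> {0..tf}) \<and>
     smooth_upto (\<lambda>(x, t). J x t) (\<Omega> \<times> {0..tf}) \<and>
     smooth_upto (\<lambda>(x, t). \<psi> x t) (\<Omega> \<times> {0..tf}) \<and>
     smooth_upto (\<lambda>(x, t). \<phi> x t) (\<Omega> \<times> {0..tf}) \<and>
     (\<forall>x\<in>\<Omega>. \<forall>t\<in>{0..tf}.
        time_deriv tf T x t + c0 * divergence (\<lambda>y. J y t) x = 0 \<and>
        time_deriv tf J x t + c0 *\<^sub>R grad (\<lambda>y. T y t) x + ch *\<^sub>R curl (\<lambda>y. \<psi> y t) x
          = - (relaxation_rate \<tau> *\<^sub>R J x t) \<and>
        time_deriv tf \<psi> x t - ch *\<^sub>R curl (\<lambda>y. J y t) x + ch *\<^sub>R grad (\<lambda>y. \<phi> y t) x = 0 \<and>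
        time_deriv tf \<phi> x t + ch * divergence (\<lambda>y. \<psi> y t) x = 0)"

definition vorticity :: "(real^3 \<Rightarrow> real \<Rightarrow> real^3) \<Rightarrow> real^3 \<Rightarrow> real \<Rightarrow> real^3" where
  "vorticity F x t = curl (\<lambda>y. F y t) x"

definition rot_energy_density ::
    "(real^3 \<Rightarrow> real \<Rightarrow> real^3) \<Rightarrow> (real^3 \<Rightarrow> real \<Rightarrow> real^3) \<Rightarrow> real^3 \<Rightarrow> real \<Rightarrow> real" where
  "rot_energy_density J \<psi> x t = 1/2 * ((norm (vorticity J x t))\<^sup>2 + (norm (vorticity \<psi> x t))\<^sup>2)"

definition rot_energy ::
    "(real^3) set \<Rightarrow> (real^3 \<Rightarrow> real \<Rightarrow> real^3) \<Rightarrow> (real^3 \<Rightarrow> real \<Rightarrow> real^3) \<Rightarrow> real \<Rightarrow> real" where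
  "rot_energy \<Omega> J \<psi> t = (LINT x:\<Omega>|lborel. rot_energy_density J \<psi> x t)"

definition rot_flux ::
    "real \<Rightarrow> (real^3 \<Rightarrow> real \<Rightarrow> real^3) \<Rightarrow> (real^3 \<Rightarrow> real \<Rightarrow> real^3) \<Rightarrow> real^3 \<Rightarrow> real \<Rightarrow> real^3" where
  "rot_flux ch J \<psi> x t = ch *\<^sub>R cross3 (vorticity \<psi> x t) (vorticity J x t)"

end

theory Submission
  imports Defs
begin

text \<open>
  Taking the curl of the two vector equations removes the gradients and leaves
  \<open>\<partial>\<^sub>t \<omega>\<^sub>J = - c\<^sub>h curl \<omega>\<^sub>\<psi> - \<omega>\<^sub>J / \<tau>\<close> and \<open>\<partial>\<^sub>t \<omega>\<^sub>\<psi> = c\<^sub>h curl \<omega>\<^sub>J\<close>; pairing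
  with \<open>\<omega>\<^sub>J\<close> and \<open>\<omega>\<^sub>\<psi>\<close> gives the local balance. Its integral is obtained without differentiating
  under the integral sign: the fundamental theorem of calculus in \<open>t\<close> at each \<open>x\<close>, then Fubini,
  then the divergence theorem on each time slice. The second derivatives commute at the end times
  \<open>0\<close> and \<open>tf\<close> too, by continuity from the open cylinder.
\<close>

subsection \<open>Regularity up to the boundary\<close>

lemma extends_continuously_imp_continuous_on:
  "extends_continuously f S \<Longrightarrow> continuous_on S f"
  unfolding extends_continuously_def
  by (metis closure_subset continuous_on_cong continuous_on_subset)

text \<open>The extension of \<open>f\<close> may take values at boundary points of \<open>S\<close>
  that \<open>f\<close> itself never takes, which is why \<open>h\<close> is asked to be continuous
  everywhere.\<close>

lemma extends_continuously_compose:
  assumes "extends_continuously f S" "\<And>y. isCont h y"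
  shows "extends_continuously (\<lambda>x. h (f x)) S"
proof -
  obtain g where g: "continuous_on (closure S) g" "\<forall>x\<in>S. g x = f x"
    using assms(1) unfolding extends_continuously_def by blast
  have "continuous_on (closure S) (\<lambda>x. h (g x))"
    using continuous_on_compose2[of UNIV h "closure S" g] assms(2) g(1)
    by (simp add: continuous_at_imp_continuous_on)
  then show ?thesis
    unfolding extends_continuously_def using g(2) by (intro exI[of _ "\<lambda>x. h (g x)"]) auto
qed

lemma extends_continuously_Pair:
  assumes "extends_continuously f S" "extends_continuously g S"
  shows "extends_continuously (\<lambda>x. (f x, g x)) S"
proof -
  obtain f' g' where "continuous_on (closure S) f'" "\<forall>x\<in>S. f' x = f x"
      "continuous_on (closure S) g'" "\<forall>x\<in>S. g' x = g x"
    using assms unfolding extends_continuously_def by blast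
  then show ?thesis
    unfolding extends_continuously_def
    by (intro exI[of _ "\<lambda>x. (f' x, g' x)"]) (auto intro: continuous_on_Pair)
qed

lemma extends_continuously_cong:
  "(\<And>x. x \<in> S \<Longrightarrow> f x = g x) \<Longrightarrow> extends_continuously f S \<longleftrightarrow> extends_continuously g S"
  unfolding extends_continuously_def by simp

text \<open>\<open>closure S\<close> is closed and bounded, hence compact, and the continuous
  extension has a bounded image on it.\<close>

lemma extends_continuously_imp_bounded:
  fixes f :: "'a::heine_borel \<Rightarrow> 'b::metric_space"
  assumes "extends_continuously f S" "bounded S"
  shows "bounded (f ` S)"
proof -
  obtain g where g: "continuous_on (closure S) g" "\<forall>x\<in>S. g x = f x"
    using assms unfolding extends_continuously_def by blast
  have "bounded (g ` closure S)"
    using assms(2) g(1) by (intro compact_imp_bounded compact_continuous_image) auto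
  then show ?thesis
    by (rule bounded_subset) (use g(2) closure_subset in force)
qed

lemma Ck_upto_imp_extends_continuously: "Ck_upto k f S \<Longrightarrow> extends_continuously f S"
  by (cases k) auto

lemma Ck_upto_SucE:
  assumes "Ck_upto (Suc k) f S"
  obtains f' where "\<And>x. x \<in> S \<Longrightarrow> (f has_derivative f' x) (at x within S)"
    "\<And>v. Ck_upto k (\<lambda>x. f' x v) S"
  using assms by auto

text \<open>The recursion in \<open>Ck_upto\<close> descends to derivatives, so lowering the order
  is an induction; the same \<open>f'\<close> stays the witness.\<close>

lemma Ck_upto_SucD: "Ck_upto (Suc k) f S \<Longrightarrow> Ck_upto k f S"
proof (induction k arbitrary: f)
  case (Suc k)
  then obtain f' where "\<And>x. x \<in> S \<Longrightarrow> (f has_derivative f' x) (at x within S)"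
      "\<And>v. Ck_upto (Suc k) (\<lambda>x. f' x v) S"
    by auto
  then show ?case
    using Suc.IH Ck_upto_imp_extends_continuously[OF Suc.prems]
    by (auto simp del: Ck_upto.simps(1) intro!: exI[of _ f'])
qed simp

lemma has_derivative_within_cong:
  assumes "\<And>x. x \<in> S \<Longrightarrow> f x = g x" "x \<in> S"
  shows "(f has_derivative f') (at x within S) \<longleftrightarrow> (g has_derivative f') (at x within S)"
  using has_derivative_transform[of x S g f f'] has_derivative_transform[of x S f g f'] assms
  by auto

text \<open>Derivatives are taken within \<open>S\<close>, so only values on \<open>S\<close> count.
  This lets a field be replaced by a formula that agrees with it only on the cylinder.\<close>

lemma Ck_upto_cong:
  assumes "\<And>x. x \<in> S \<Longrightarrow> f x = g x"
  shows "Ck_upto k f S \<longleftrightarrow> Ck_upto k g S"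
proof (cases k)
  case 0
  then show ?thesis using extends_continuously_cong[of S f g] assms by simp
next
  case (Suc m)
  then show ?thesis
    unfolding Suc
    using extends_continuously_cong[of S f g] has_derivative_within_cong[of S f g] assms by simp
qed

lemma Ck_upto_bounded_linear:
  assumes "bounded_linear h" "Ck_upto k f S"
  shows "Ck_upto k (\<lambda>x. h (f x)) S"
  using assms(2)
proof (induction k arbitrary: f)
  case 0
  then show ?case
    using extends_continuously_compose linear_continuous_at[OF assms(1)] by auto
next
  case (Suc k)
  then obtain f' where f': "\<And>x. x \<in> S \<Longrightarrow> (f has_derivative f' x) (at x within S)"
      "\<And>v. Ck_upto k (\<lambda>x. f' x v) S"
    by auto
  have "extends_continuously (\<lambda>x. h (f x)) S"
    using Suc.prems extends_continuously_compose linear_continuous_at[OF assms(1)] by auto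
  moreover have "((\<lambda>x. h (f x)) has_derivative (\<lambda>v. h (f' x v))) (at x within S)" if "x \<in> S" for x
    using bounded_linear.has_derivative[OF assms(1) f'(1)[OF that]] .
  ultimately show ?case
    using Suc.IH f'(2) by (auto intro!: exI[of _ "\<lambda>x v. h (f' x v)"])
qed

lemma Ck_upto_add:
  assumes "Ck_upto k f S" "Ck_upto k g S"
  shows "Ck_upto k (\<lambda>x. f x + g x) S"
  using assms
proof (induction k arbitrary: f g)
  case 0
  then show ?case
    using extends_continuously_compose[OF extends_continuously_Pair[of f S g],
        where h = "\<lambda>p. fst p + snd p"]
    by simp
next
  case (Suc k)
  obtain f' where f': "\<And>x. x \<in> S \<Longrightarrow> (f has_derivative f' x) (at x within S)"
      "\<And>v. Ck_upto k (\<lambda>x. f' x v) S"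
    using Ck_upto_SucE[OF Suc.prems(1)] by metis
  obtain g' where g': "\<And>x. x \<in> S \<Longrightarrow> (g has_derivative g' x) (at x within S)"
      "\<And>v. Ck_upto k (\<lambda>x. g' x v) S"
    using Ck_upto_SucE[OF Suc.prems(2)] by metis
  have "extends_continuously (\<lambda>x. f x + g x) S"
    using Suc.prems extends_continuously_compose[OF extends_continuously_Pair[of f S g],
        where h = "\<lambda>p. fst p + snd p"]
    by simp
  then show ?case
    using Suc.IH f' g'
    by (auto intro!: exI[of _ "\<lambda>x v. f' x v + g' x v"] has_derivative_add)
qed

text \<open>In the Leibniz rule each derivative is paired with an undifferentiated factor. That
  factor has order \<open>Suc k\<close> and is lowered to \<open>k\<close> by
  \<open>Ck_upto_SucD\<close> before the induction hypothesis applies.\<close>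

lemma (in bounded_bilinear) Ck_upto:
  assumes "Ck_upto k f S" "Ck_upto k g S"
  shows "Ck_upto k (\<lambda>x. prod (f x) (g x)) S"
  using assms
proof (induction k arbitrary: f g)
  case (0 f g)
  have "isCont (\<lambda>p. prod (fst p) (snd p)) y" for y
    by (intro continuous) (auto intro: continuous_intros)
  then show ?case
    using extends_continuously_compose[OF extends_continuously_Pair[of f S g],
        where h = "\<lambda>p. prod (fst p) (snd p)"] 0
    by simp
next
  case (Suc k f g)
  obtain f' where f': "\<And>x. x \<in> S \<Longrightarrow> (f has_derivative f' x) (at x within S)"
      "\<And>v. Ck_upto k (\<lambda>x. f' x v) S"
    using Ck_upto_SucE[OF Suc.prems(1)] by metis
  obtain g' where g': "\<And>x. x \<in> S \<Longrightarrow> (g has_derivative g' x) (at x within S)"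
      "\<And>v. Ck_upto k (\<lambda>x. g' x v) S"
    using Ck_upto_SucE[OF Suc.prems(2)] by metis
  have "isCont (\<lambda>p. prod (fst p) (snd p)) y" for y
    by (intro continuous) (auto intro: continuous_intros)
  then have "extends_continuously (\<lambda>x. prod (f x) (g x)) S"
    using extends_continuously_compose[OF extends_continuously_Pair[of f S g],
        where h = "\<lambda>p. prod (fst p) (snd p)"] Suc.prems
    by simp
  moreover have "Ck_upto k f S" "Ck_upto k g S"
    using Suc.prems Ck_upto_SucD by auto
  ultimately show ?case
    using Suc.IH f' g'
    by (auto intro!: exI[of _ "\<lambda>x v. prod (f x) (g' x v) + prod (f' x v) (g x)"] FDERIV Ck_upto_add)
qed

text \<open>The slice is a composition with \<open>x \<mapsto> (x, t)\<close>, whose derivative is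
  \<open>v \<mapsto> (v, 0)\<close>; the extension restricts because
  \<open>closure (A \<times> B)\<close> is the product of the closures. It turns space-time
  smoothness into the spatial regularity that the divergence theorem asks for.\<close>

lemma Ck_upto_slice:
  assumes "Ck_upto k F (A \<times> B)" "t \<in> B"
  shows "Ck_upto k (\<lambda>x. F (x, t)) A"
  using assms(1)
proof (induction k arbitrary: F)
  have ext: "extends_continuously (\<lambda>x. F (x, t)) A" if "extends_continuously F (A \<times> B)"
    for F :: "'a \<times> 'b \<Rightarrow> 'c"
  proof -
    obtain g where g: "continuous_on (closure (A \<times> B)) g" "\<forall>x\<in>A \<times> B. g x = F x"
      using \<open>extends_continuously F (A \<times> B)\<close> unfolding extends_continuously_def by blast
    have "continuous_on (closure A) (\<lambda>x. g (x, t))"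
      by (rule continuous_on_compose2[OF g(1)])
        (use assms(2) closure_subset in \<open>auto simp: closure_Times intro!: continuous_intros\<close>)
    then show ?thesis
      unfolding extends_continuously_def using g(2) assms(2) by (intro exI[of _ "\<lambda>x. g (x, t)"]) auto
  qed
  {
    case 0
    then show ?case using ext by simp
  next
    case (Suc k)
    then obtain F' where F': "\<And>p. p \<in> A \<times> B \<Longrightarrow> (F has_derivative F' p) (at p within A \<times> B)"
        "\<And>v. Ck_upto k (\<lambda>p. F' p v) (A \<times> B)"
      by auto
    have "((\<lambda>x. F (x, t)) has_derivative (\<lambda>v. F' (x, t) (v, 0))) (at x within A)" if "x \<in> A" for x
    proof (rule has_derivative_in_compose2[where g = F and t = "A \<times> B" and f = "\<lambda>x. (x, t)"])
      show "((\<lambda>x. (x, t)) has_derivative (\<lambda>v. (v, 0))) (at x within A)"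
        by (intro has_derivative_Pair) (auto intro: derivative_intros)
    qed (use that assms(2) F'(1) in auto)
    then show ?case
      using Suc ext Suc.IH[OF F'(2)] by (auto intro!: exI[of _ "\<lambda>x v. F' (x, t) (v, 0)"])
  }
qed

subsection \<open>Symmetry of second derivatives\<close>

text \<open>Two applications of the mean value theorem to the second difference of \<open>f\<close> over the
  parallelogram spanned by \<open>h u\<close> and \<open>h v\<close>.\<close>

lemma second_difference_mean_value:
  fixes f :: "'a::real_normed_vector \<Rightarrow> real"
  assumes f: "\<And>q. q \<in> U \<Longrightarrow> (f has_derivative f' q) (at q)"
    and fu: "\<And>q. q \<in> U \<Longrightarrow> ((\<lambda>q. f' q u) has_derivative A q) (at q)"
    and U: "\<And>a b. \<lbrakk>0 \<le> a; a \<le> h; 0 \<le> b; b \<le> h\<rbrakk> \<Longrightarrow> p + a *\<^sub>R u + b *\<^sub>R v \<in> U"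
    and "0 < h"
  shows "\<exists>a b. 0 < a \<and> a < h \<and> 0 < b \<and> b < h \<and>
     f (p + h *\<^sub>R u + h *\<^sub>R v) - f (p + h *\<^sub>R u) - (f (p + h *\<^sub>R v) - f p)
       = h\<^sup>2 * A (p + a *\<^sub>R u + b *\<^sub>R v) v"
proof -
  have line: "((\<lambda>s. g (q + s *\<^sub>R w)) has_real_derivative g' w) (at s)"
    if "(g has_derivative g') (at (q + s *\<^sub>R w))" for g g' s and q w :: 'a
  proof -
    have "((\<lambda>s. g (q + s *\<^sub>R w)) has_derivative (\<lambda>d. g' (d *\<^sub>R w))) (at s)"
      by (rule has_derivative_compose[where g = g]) (auto intro!: derivative_eq_intros that)
    moreover have "(\<lambda>d. g' (d *\<^sub>R w)) = (*) (g' w)"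
      using linear_scale[OF has_derivative_linear[OF that]] by (simp add: fun_eq_iff)
    ultimately show ?thesis
      by (simp add: has_field_derivative_def)
  qed
  have 1: "((\<lambda>s. f (p + h *\<^sub>R v + s *\<^sub>R u) - f (p + s *\<^sub>R u)) has_real_derivative
      f' (p + h *\<^sub>R v + s *\<^sub>R u) u - f' (p + s *\<^sub>R u) u) (at s)" if "0 \<le> s" "s \<le> h" for s
    using that \<open>0 < h\<close> U[of s 0] U[of s h] by (intro DERIV_diff line f) (auto simp: ac_simps)
  obtain a where a: "0 < a" "a < h"
    "f (p + h *\<^sub>R v + h *\<^sub>R u) - f (p + h *\<^sub>R u) - (f (p + h *\<^sub>R v) - f p)
       = h * (f' (p + h *\<^sub>R v + a *\<^sub>R u) u - f' (p + a *\<^sub>R u) u)"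
    using MVT2[OF \<open>0 < h\<close> 1] by auto
  have 2: "((\<lambda>s. f' (p + a *\<^sub>R u + s *\<^sub>R v) u) has_real_derivative A (p + a *\<^sub>R u + s *\<^sub>R v) v) (at s)"
    if "0 \<le> s" "s \<le> h" for s
    by (rule line[where g = "\<lambda>q. f' q u"]) (use that a U[of a s] fu in auto)
  obtain b where b: "0 < b" "b < h"
    "f' (p + a *\<^sub>R u + h *\<^sub>R v) u - f' (p + a *\<^sub>R u) u = h * A (p + a *\<^sub>R u + b *\<^sub>R v) v"
    using MVT2[OF \<open>0 < h\<close> 2] by auto
  show ?thesis
    using a b by (intro exI[of _ a] exI[of _ b]) (auto simp: ac_simps power2_eq_square)
qed

text \<open>The second difference over a parallelogram is unchanged when \<open>u\<close> and
  \<open>v\<close> are exchanged, and by the mean value theorem it is \<open>h\<^sup>2\<close> times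
  either mixed derivative at some nearby point. Continuity at \<open>p\<close> then rules out two
  different values there.\<close>

lemma symmetric_second_derivative_real:
  fixes f :: "'a::real_normed_vector \<Rightarrow> real"
  assumes "open U" "p \<in> U"
    and f: "\<And>q. q \<in> U \<Longrightarrow> (f has_derivative f' q) (at q)"
    and fu: "\<And>q. q \<in> U \<Longrightarrow> ((\<lambda>q. f' q u) has_derivative A q) (at q)"
    and fv: "\<And>q. q \<in> U \<Longrightarrow> ((\<lambda>q. f' q v) has_derivative B q) (at q)"
    and contA: "isCont (\<lambda>q. A q v) p" and contB: "isCont (\<lambda>q. B q u) p"
  shows "A p v = B p u"
proof (rule ccontr)
  \<comment> \<open>Half the supposed gap: near \<open>p\<close> each mixed derivative moves by less
    than \<open>d\<close>, so if the two share a value, the gap is less than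
    \<open>2 * d\<close>.\<close>
  define d where "d = \<bar>A p v - B p u\<bar> / 2"
  assume "A p v \<noteq> B p u"
  then have "0 < d" by (simp add: d_def)
  obtain \<delta> where "0 < \<delta>" and \<delta>:
    "\<And>q. dist q p < \<delta> \<Longrightarrow> q \<in> U \<and> \<bar>A q v - A p v\<bar> < d \<and> \<bar>B q u - B p u\<bar> < d"
  proof -
    have "eventually (\<lambda>q. q \<in> U) (nhds p)"
      using assms by (simp add: eventually_nhds_in_open)
    moreover have "eventually (\<lambda>q. dist (A q v) (A p v) < d) (nhds p)"
      using contA \<open>0 < d\<close> tendsto_at_iff_tendsto_nhds[of "\<lambda>q. A q v" p]
      by (simp add: isCont_def tendstoD)
    moreover have "eventually (\<lambda>q. dist (B q u) (B p u) < d) (nhds p)"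
      using contB \<open>0 < d\<close> tendsto_at_iff_tendsto_nhds[of "\<lambda>q. B q u" p]
      by (simp add: isCont_def tendstoD)
    ultimately have "eventually (\<lambda>q. q \<in> U \<and> \<bar>A q v - A p v\<bar> < d \<and> \<bar>B q u - B p u\<bar> < d) (nhds p)"
      by eventually_elim (auto simp: dist_real_def)
    then show ?thesis
      using that unfolding eventually_nhds_metric by blast
  qed
  \<comment> \<open>With this \<open>h\<close> the whole parallelogram lies within
    \<open>\<delta> / 2\<close> of \<open>p\<close>. The summand \<open>1\<close> keeps the
    denominator positive when \<open>u\<close> and \<open>v\<close> are zero.\<close>
  define h where "h = \<delta> / (2 * (norm u + norm v + 1))"
  have N: "0 < norm u + norm v + 1" by (smt (verit) norm_ge_zero)
  have "0 < h" using \<open>0 < \<delta>\<close> N by (simp add: h_def)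
  have near: "dist (p + a *\<^sub>R u + b *\<^sub>R v) p < \<delta>" if "0 \<le> a" "a \<le> h" "0 \<le> b" "b \<le> h" for a b
  proof -
    have "dist (p + a *\<^sub>R u + b *\<^sub>R v) p = norm (a *\<^sub>R u + b *\<^sub>R v)"
      by (simp add: dist_norm add.assoc)
    also have "\<dots> \<le> a * norm u + b * norm v"
      using that by (metis abs_of_nonneg norm_scaleR norm_triangle_ineq)
    also have "\<dots> \<le> h * (norm u + norm v + 1)"
      using that \<open>0 < h\<close> by (simp add: distrib_left add_increasing2 add_mono mult_right_mono)
    also have "\<dots> = \<delta> / 2"
      using N unfolding h_def by (simp only: times_divide_eq_left times_divide_eq_right mult.commute[of 2]
          divide_divide_eq_left[symmetric] nonzero_mult_div_cancel_right[of "norm u + norm v + 1"])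
    also have "\<dots> < \<delta>"
      using \<open>0 < \<delta>\<close> by simp
    finally show ?thesis .
  qed
  obtain a b where ab: "0 < a" "a < h" "0 < b" "b < h"
     "f (p + h *\<^sub>R u + h *\<^sub>R v) - f (p + h *\<^sub>R u) - (f (p + h *\<^sub>R v) - f p)
       = h\<^sup>2 * A (p + a *\<^sub>R u + b *\<^sub>R v) v"
    using second_difference_mean_value[OF f fu _ \<open>0 < h\<close>, of U p v] near \<delta> by metis
  \<comment> \<open>Exchanging \<open>u\<close> and \<open>v\<close> describes the same
    parallelogram, so the mean value lemma can be applied a second time, now producing
    \<open>B\<close>.\<close>
  have swapped: "p + a *\<^sub>R v + b *\<^sub>R u \<in> U" if "0 \<le> a" "a \<le> h" "0 \<le> b" "b \<le> h" for a b
    using \<delta>[OF near[OF that(3,4,1,2)]] by (simp add: add.assoc add.commute[of "a *\<^sub>R v"])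
  obtain a' b' where ab': "0 < a'" "a' < h" "0 < b'" "b' < h"
     "f (p + h *\<^sub>R v + h *\<^sub>R u) - f (p + h *\<^sub>R v) - (f (p + h *\<^sub>R u) - f p)
       = h\<^sup>2 * B (p + a' *\<^sub>R v + b' *\<^sub>R u) u"
    using second_difference_mean_value[where U = U and u = v and v = u, OF f fv swapped \<open>0 < h\<close>]
    by auto
  have "h\<^sup>2 * A (p + a *\<^sub>R u + b *\<^sub>R v) v = h\<^sup>2 * B (p + b' *\<^sub>R u + a' *\<^sub>R v) u"
    using ab(5) ab'(5) by (simp add: algebra_simps)
  then have "A (p + a *\<^sub>R u + b *\<^sub>R v) v = B (p + b' *\<^sub>R u + a' *\<^sub>R v) u"
    using \<open>0 < h\<close> by simp
  then have "\<bar>A p v - B p u\<bar> < 2 * d"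
    using \<delta>[OF near, of a b] \<delta>[OF near, of b' a'] ab ab' by (simp add: abs_if split: if_splits)
  then show False by (simp add: d_def)
qed

text \<open>The mean value theorem gives an equality for real functions only, so the real case is
  applied to \<open>f q \<bullet> w\<close> for each basis vector \<open>w\<close>.\<close>

lemma symmetric_second_derivative:
  fixes f :: "'a::real_normed_vector \<Rightarrow> 'b::euclidean_space"
  assumes "open U" "p \<in> U"
    and f: "\<And>q. q \<in> U \<Longrightarrow> (f has_derivative f' q) (at q)"
    and fu: "\<And>q. q \<in> U \<Longrightarrow> ((\<lambda>q. f' q u) has_derivative A q) (at q)"
    and fv: "\<And>q. q \<in> U \<Longrightarrow> ((\<lambda>q. f' q v) has_derivative B q) (at q)"
    and "isCont (\<lambda>q. A q v) p" and "isCont (\<lambda>q. B q u) p"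
  shows "A p v = B p u"
proof (rule euclidean_eqI)
  fix w :: 'b
  show "A p v \<bullet> w = B p u \<bullet> w"
    by (rule symmetric_second_derivative_real[of U p "\<lambda>q. f q \<bullet> w" "\<lambda>q x. f' q x \<bullet> w" u
          "\<lambda>q x. A q x \<bullet> w" v "\<lambda>q x. B q x \<bullet> w"])
      (use assms in \<open>auto intro!: has_derivative_inner_left isCont_inner\<close>)
qed

subsection \<open>Calculus on a space-time cylinder\<close>

lemma smooth_upto_cong:
  "(\<And>x. x \<in> S \<Longrightarrow> f x = g x) \<Longrightarrow> smooth_upto f S \<longleftrightarrow> smooth_upto g S"
  unfolding smooth_upto_def using Ck_upto_cong[of S f g] by simp

lemma smooth_upto_bounded_linear:
  "bounded_linear h \<Longrightarrow> smooth_upto f S \<Longrightarrow> smooth_upto (\<lambda>x. h (f x)) S"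
  unfolding smooth_upto_def by (simp add: Ck_upto_bounded_linear)

lemma smooth_upto_add:
  "smooth_upto f S \<Longrightarrow> smooth_upto g S \<Longrightarrow> smooth_upto (\<lambda>x. f x + g x) S"
  unfolding smooth_upto_def by (simp add: Ck_upto_add)

lemma (in bounded_bilinear) smooth_upto:
  "smooth_upto f S \<Longrightarrow> smooth_upto g S \<Longrightarrow> smooth_upto (\<lambda>x. prod (f x) (g x)) S"
  unfolding smooth_upto_def by (simp add: Ck_upto)

lemma smooth_upto_imp_extends_continuously: "smooth_upto f S \<Longrightarrow> extends_continuously f S"
  unfolding smooth_upto_def by (metis Ck_upto_imp_extends_continuously)

lemma bounded_bilinear_cross3: "bounded_bilinear cross3"
  using bilinear_cross bilinear_conv_bounded_bilinear by blast

text \<open>Differentiating within \<open>S\<close> treats spatial derivatives and the one-sided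
  time derivatives at \<open>0\<close> and \<open>tf\<close> alike. With the direction
  \<open>v\<close> fixed, the result is a field of the same type, so the operator can be
  iterated.\<close>

definition deriv_within :: "'a::real_normed_vector set \<Rightarrow> 'a \<Rightarrow> ('a \<Rightarrow> 'b::real_normed_vector) \<Rightarrow> 'a \<Rightarrow> 'b"
  where "deriv_within S v f p = frechet_derivative f (at p within S) v"

locale cylinder =
  fixes \<Omega> :: "(real^3) set" and tf :: real
  assumes open_base: "open \<Omega>" and tf_pos: "0 < tf"
begin

abbreviation "S \<equiv> \<Omega> \<times> {0..tf}"
abbreviation "D \<equiv> deriv_within S"
abbreviation "Dx i \<equiv> D (axis i 1, 0)"
abbreviation "Dt \<equiv> D (0, 1)"

text \<open>A derivative within a set is determined once arbitrarily small displacements in each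
  basis direction stay in the set. Openness of \<open>\<Omega>\<close> gives this in space and the
  positive length of \<open>[0, tf]\<close> in time.\<close>

lemma has_derivative_unique_cylinder:
  fixes f :: "(real^3) \<times> real \<Rightarrow> 'b::real_normed_vector"
  assumes "p \<in> S" "(f has_derivative f') (at p within S)" "(f has_derivative f'') (at p within S)"
  shows "f' = f''"
proof (rule frechet_derivative_unique_within[OF assms(2,3)])
  fix i :: "(real^3) \<times> real" and e :: real
  assume "i \<in> Basis" "0 < e"
  obtain x t where p: "p = (x, t)" "x \<in> \<Omega>" "0 \<le> t" "t \<le> tf"
    using assms(1) by (cases p) auto
  obtain r where "0 < r" and r: "ball x r \<subseteq> \<Omega>"
    using open_base p(2) open_contains_ball by blast
  consider (space) u where "u \<in> Basis" "i = (u, 0)" | (time) "i = (0, 1)"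
    using \<open>i \<in> Basis\<close> by (auto simp: Basis_prod_def)
  then show "\<exists>d. 0 < \<bar>d\<bar> \<and> \<bar>d\<bar> < e \<and> p + d *\<^sub>R i \<in> S"
  proof cases
    case space
    define d where "d = min r e / 2"
    have d: "0 < d" "d < r" "d < e" using \<open>0 < r\<close> \<open>0 < e\<close> by (auto simp: d_def min_def)
    then have "x + d *\<^sub>R u \<in> \<Omega>"
      using r space by (auto simp: dist_norm subset_iff)
    then show ?thesis
      using d p space by (intro exI[of _ d]) auto
  next
    case time
    \<comment> \<open>At the final time the displacement must go backwards; in that branch
      \<open>t = tf\<close>, so \<open>min tf e / 2\<close> does not overshoot
      \<open>0\<close>.\<close>
    define d where "d = (if t < tf then min (tf - t) e / 2 else - (min tf e / 2))"
    have "0 < \<bar>d\<bar>" "\<bar>d\<bar> < e" "0 \<le> t + d" "t + d \<le> tf"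
      using p \<open>0 < e\<close> tf_pos by (auto simp: d_def min_def abs_if field_simps)
    then show ?thesis
      using p time by (intro exI[of _ d]) auto
  qed
qed

lemma deriv_within_eqI:
  assumes "p \<in> S" "(f has_derivative f') (at p within S)"
  shows "D v f p = f' v"
proof -
  have "(f has_derivative frechet_derivative f (at p within S)) (at p within S)"
    using assms(2) by (metis differentiableI frechet_derivative_works)
  then show ?thesis
    using has_derivative_unique_cylinder[OF assms(1) _ assms(2)] by (simp add: deriv_within_def)
qed

lemma smooth_has_derivative:
  assumes "smooth_upto f S" "p \<in> S"
  shows "(f has_derivative (\<lambda>v. D v f p)) (at p within S)"
proof -
  have "Ck_upto (Suc 0) f S" using assms unfolding smooth_upto_def by blast
  then obtain f' where f': "(f has_derivative f') (at p within S)"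
    using assms(2) by auto
  then have "(\<lambda>v. D v f p) = f'" using assms deriv_within_eqI by blast
  then show ?thesis using f' by simp
qed

text \<open>The witness \<open>f'\<close> in \<open>Ck_upto\<close> is existential and might change
  with the order. Uniqueness on the cylinder identifies every such witness with \<open>D\<close>, so
  smoothness passes to \<open>D v f\<close> at each order.\<close>

lemma smooth_deriv_within:
  assumes "smooth_upto f S"
  shows "smooth_upto (D v f) S"
  unfolding smooth_upto_def
proof
  fix k
  have "Ck_upto (Suc k) f S" using assms unfolding smooth_upto_def by blast
  then obtain f' where f': "\<And>p. p \<in> S \<Longrightarrow> (f has_derivative f' p) (at p within S)"
      "\<And>v. Ck_upto k (\<lambda>p. f' p v) S"
    using Ck_upto_SucE by metis
  then have "\<And>p. p \<in> S \<Longrightarrow> D v f p = f' p v" using deriv_within_eqI by blast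
  then show "Ck_upto k (D v f) S"
    using f'(2) Ck_upto_cong[of S "D v f" "\<lambda>p. f' p v"] by blast
qed

lemma deriv_within_cong:
  assumes "\<And>q. q \<in> S \<Longrightarrow> f q = g q" "p \<in> S"
  shows "D v f p = D v g p"
  using has_derivative_within_cong[of S f g p, OF assms]
  unfolding deriv_within_def frechet_derivative_def by simp

lemma deriv_within_bounded_linear:
  assumes "bounded_linear h" "smooth_upto f S" "p \<in> S"
  shows "D v (\<lambda>q. h (f q)) p = h (D v f p)"
  using bounded_linear.has_derivative[OF assms(1) smooth_has_derivative[OF assms(2,3)]] assms(3)
  by (rule deriv_within_eqI[rotated])

lemma deriv_within_add:
  assumes "smooth_upto f S" "smooth_upto g S" "p \<in> S"
  shows "D v (\<lambda>q. f q + g q) p = D v f p + D v g p"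
  using has_derivative_add[OF smooth_has_derivative[OF assms(1,3)] smooth_has_derivative[OF assms(2,3)]] assms(3)
  by (rule deriv_within_eqI[rotated])

lemma deriv_within_bilinear:
  assumes "bounded_bilinear h" "smooth_upto f S" "smooth_upto g S" "p \<in> S"
  shows "D v (\<lambda>q. h (f q) (g q)) p = h (f p) (D v g p) + h (D v f p) (g p)"
  using bounded_bilinear.FDERIV[OF assms(1) smooth_has_derivative[OF assms(2,4)]
      smooth_has_derivative[OF assms(3,4)]] assms(4)
  by (rule deriv_within_eqI[rotated])

lemma has_vector_derivative_time:
  assumes "smooth_upto f S" "x \<in> \<Omega>" "t \<in> {0..tf}"
  shows "((\<lambda>s. f (x, s)) has_vector_derivative Dt f (x, t)) (at t within {0..tf})"
proof -
  have f': "(f has_derivative (\<lambda>v. D v f (x, t))) (at (x, t) within S)"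
    using assms by (intro smooth_has_derivative) auto
  have "((\<lambda>s. f (x, s)) has_derivative (\<lambda>h. D (0, h) f (x, t))) (at t within {0..tf})"
  proof (rule has_derivative_in_compose2[where g = f and t = S and f = "\<lambda>s. (x, s)"])
    show "((\<lambda>s. (x, s)) has_derivative (\<lambda>h. (0, h))) (at t within {0..tf})"
      by (auto intro!: derivative_eq_intros)
    show "\<And>q. q \<in> S \<Longrightarrow> (f has_derivative (\<lambda>v. D v f q)) (at q within S)"
      using assms(1) smooth_has_derivative by blast
  qed (use assms in auto)
  moreover have "(\<lambda>h. D (0, h) f (x, t)) = (\<lambda>h. h *\<^sub>R Dt f (x, t))"
  proof
    fix h
    show "D (0, h) f (x, t) = h *\<^sub>R Dt f (x, t)"
      using linear_scale[OF has_derivative_linear[OF f'], of h "(0, 1)"] by simp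
  qed
  ultimately show ?thesis by (simp add: has_vector_derivative_def)
qed

lemma time_deriv_eq:
  assumes "smooth_upto (\<lambda>(x, t). F x t) S" "x \<in> \<Omega>" "t \<in> {0..tf}"
  shows "time_deriv tf F x t = Dt (\<lambda>(x, t). F x t) (x, t)"
  unfolding time_deriv_def
  by (rule vector_derivative_within_cbox[of 0 tf t, unfolded box_real, OF tf_pos assms(3)])
    (use has_vector_derivative_time[OF assms] in simp)

lemma partial_eq:
  assumes "smooth_upto (\<lambda>(x, t). F x t) S" "x \<in> \<Omega>" "t \<in> {0..tf}"
  shows "partial i (\<lambda>y. F y t) x = Dx i (\<lambda>(x, t). F x t) (x, t)"
proof -
  define f where "f = (\<lambda>(x, t). F x t)"
  \<comment> \<open>\<open>partial\<close> is a limit over all small \<open>h\<close>, while the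
    derivative at hand is within \<open>S\<close>. Parameters in \<open>H\<close> keep the point in
    \<open>\<Omega>\<close>, and since \<open>H\<close> is an open neighbourhood of \<open>0\<close>
    the limit within \<open>H\<close> is the full limit.\<close>
  define H where "H = (\<lambda>h. x + h *\<^sub>R axis i 1) -` \<Omega>"
  have "open H" unfolding H_def
    by (intro open_vimage open_base continuous_intros)
  have "0 \<in> H" using assms(2) by (simp add: H_def)
  have f': "(f has_derivative (\<lambda>v. D v f (x, t))) (at (x, t) within S)"
    using assms unfolding f_def by (intro smooth_has_derivative) auto
  have "((\<lambda>h. (x + h *\<^sub>R axis i 1, t)) has_derivative (\<lambda>h. (h *\<^sub>R axis i 1, 0))) (at 0 within H)"
    by (auto intro!: derivative_eq_intros)
  moreover have "\<And>q. q \<in> S \<Longrightarrow> (f has_derivative (\<lambda>v. D v f q)) (at q within S)"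
    using assms(1) smooth_has_derivative unfolding f_def by blast
  ultimately have "((\<lambda>h. f (x + h *\<^sub>R axis i 1, t)) has_derivative
      (\<lambda>h. D (h *\<^sub>R axis i 1, 0) f (x, t))) (at 0 within H)"
    using has_derivative_in_compose2[of S f "\<lambda>q v. D v f q" "\<lambda>h. (x + h *\<^sub>R axis i 1, t)" H 0
        "\<lambda>h. (h *\<^sub>R axis i 1, 0)"] assms(3) \<open>0 \<in> H\<close>
    by (auto simp: H_def image_subset_iff)
  moreover have "(\<lambda>h. D (h *\<^sub>R axis i 1, 0) f (x, t)) = (\<lambda>h. h *\<^sub>R Dx i f (x, t))"
  proof
    fix h
    show "D (h *\<^sub>R axis i 1, 0) f (x, t) = h *\<^sub>R Dx i f (x, t)"
      using linear_scale[OF has_derivative_linear[OF f'], of h "(axis i 1, 0)"] by simp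
  qed
  ultimately have "((\<lambda>h. f (x + h *\<^sub>R axis i 1, t)) has_vector_derivative Dx i f (x, t)) (at 0)"
    using at_within_open[OF \<open>0 \<in> H\<close> \<open>open H\<close>] by (simp add: has_vector_derivative_def)
  then have "vector_derivative (\<lambda>h. f (x + h *\<^sub>R axis i 1, t)) (at 0) = Dx i f (x, t)"
    by (rule vector_derivative_at)
  then show ?thesis by (simp add: partial_def f_def)
qed

lemma deriv_within_commute:
  fixes f :: "(real^3) \<times> real \<Rightarrow> 'b::euclidean_space"
  assumes f: "smooth_upto f S" and "p \<in> S"
  shows "D u (D v f) p = D v (D u f) p"
proof -
  obtain x t where p: "p = (x, t)" "x \<in> \<Omega>" "t \<in> {0..tf}"
    using assms(2) by (cases p) auto
  \<comment> \<open>On the open cylinder derivatives within \<open>S\<close> are ordinary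
    derivatives, so the symmetry theorem for open sets applies.\<close>
  define U where "U = \<Omega> \<times> {0<..<tf}"
  have U: "open U" "U \<subseteq> S"
    unfolding U_def using open_base by (auto intro: open_Times)
  have atU: "(at q within S) = at q" if "q \<in> U" for q
    using that U by (metis at_within_interior interiorI)
  have cont: "continuous_on S (D v (D u f))" for u v
    by (intro extends_continuously_imp_continuous_on smooth_upto_imp_extends_continuously
        smooth_deriv_within f)
  have isC: "isCont (D v (D u f)) q" if "q \<in> U" for u v q
    by (rule continuous_on_interior[OF cont]) (use U that in \<open>auto intro: interiorI\<close>)
  have der: "(g has_derivative (\<lambda>v. D v g q)) (at q)" if "smooth_upto g S" "q \<in> U" for g :: "_ \<Rightarrow> 'b" and q
    using smooth_has_derivative[OF that(1), of q] that(2) U(2) atU by auto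
  have eq: "D u (D v f) q = D v (D u f) q" if "q \<in> U" for q
  proof (rule symmetric_second_derivative[OF \<open>open U\<close> that, where f = f and f' = "\<lambda>q v. D v f q"
        and A = "\<lambda>q u. D u (D v f) q" and B = "\<lambda>q v. D v (D u f) q"])
  qed (auto intro!: der f smooth_deriv_within isC that)
  \<comment> \<open>At fixed \<open>x\<close> the difference is continuous in \<open>s\<close> and
    vanishes on \<open>{0<..<tf}\<close>, hence on its closure, which contains the end
    times.\<close>
  have "D u (D v f) (x, s) - D v (D u f) (x, s) = 0" if "s \<in> closure {0<..<tf}" for s
  proof (rule continuous_constant_on_closure[OF _ _ that])
    show "continuous_on (closure {0<..<tf}) (\<lambda>s. D u (D v f) (x, s) - D v (D u f) (x, s))"
      using p tf_pos
      by (intro continuous_intros continuous_on_compose2[OF cont[of u v]] continuous_on_compose2[OF cont[of v u]]) auto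
  qed (use eq p in \<open>auto simp: U_def\<close>)
  then show ?thesis using p tf_pos by simp
qed

end

section \<open>Curl and gradient as operators on the cylinder\<close>

lemma curl_eq_sum_cross3: "curl F x = (\<Sum>i\<in>UNIV. cross3 (axis i 1) (partial i F x))"
  by (simp add: curl_def cross3_def sum_3 vec_eq_iff forall_3 axis_def)

lemma bounded_linear_cross3_right: "bounded_linear (cross3 a)"
  by (rule bounded_bilinear.bounded_linear_right[OF bounded_bilinear_cross3])

context cylinder
begin

text \<open>The formal product of nabla with \<open>F\<close>, written with the constant linear maps
  \<open>cross3 (axis i 1)\<close>. Linearity, smoothness and commutation with derivatives then come
  termwise from those of \<open>Dx i\<close>.\<close>

definition curlx :: "((real^3) \<times> real \<Rightarrow> real^3) \<Rightarrow> (real^3) \<times> real \<Rightarrow> real^3" where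
  "curlx F p = (\<Sum>i\<in>UNIV. cross3 (axis i 1) (Dx i F p))"

definition gradx :: "((real^3) \<times> real \<Rightarrow> real) \<Rightarrow> (real^3) \<times> real \<Rightarrow> real^3" where
  "gradx f p = (\<Sum>i\<in>UNIV. Dx i f p *\<^sub>R axis i 1)"

lemma curl_eq:
  assumes "smooth_upto (\<lambda>(x, t). F x t) S" "x \<in> \<Omega>" "t \<in> {0..tf}"
  shows "curl (\<lambda>y. F y t) x = curlx (\<lambda>(x, t). F x t) (x, t)"
  unfolding curl_eq_sum_cross3 curlx_def using partial_eq[OF assms] by simp

lemma grad_eq:
  assumes "smooth_upto (\<lambda>(x, t). f x t) S" "x \<in> \<Omega>" "t \<in> {0..tf}"
  shows "grad (\<lambda>y. f y t) x = gradx (\<lambda>(x, t). f x t) (x, t)"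
  unfolding grad_def gradx_def using partial_eq[OF assms]
  by (simp add: sum_3 vec_eq_iff forall_3 axis_def)

lemma smooth_scaleR: "smooth_upto f S \<Longrightarrow> smooth_upto (\<lambda>p. c *\<^sub>R f p) S"
  by (rule smooth_upto_bounded_linear[OF bounded_linear_scaleR_right])

lemma smooth_curlx: "smooth_upto F S \<Longrightarrow> smooth_upto (curlx F) S"
  unfolding curlx_def sum_3
  by (intro smooth_upto_add smooth_upto_bounded_linear[OF bounded_linear_cross3_right] smooth_deriv_within)

lemma smooth_gradx: "smooth_upto f S \<Longrightarrow> smooth_upto (gradx f) S"
  unfolding gradx_def sum_3
  by (intro smooth_upto_add smooth_upto_bounded_linear[OF bounded_linear_scaleR_left] smooth_deriv_within)

lemma deriv_within_scaleR:
  "smooth_upto f S \<Longrightarrow> p \<in> S \<Longrightarrow> D v (\<lambda>q. c *\<^sub>R f q) p = c *\<^sub>R D v f p"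
  by (rule deriv_within_bounded_linear[OF bounded_linear_scaleR_right])

lemma curlx_cong: "(\<And>q. q \<in> S \<Longrightarrow> F q = G q) \<Longrightarrow> p \<in> S \<Longrightarrow> curlx F p = curlx G p"
  unfolding curlx_def using deriv_within_cong[of F G p] by simp

lemma curlx_add:
  "smooth_upto F S \<Longrightarrow> smooth_upto G S \<Longrightarrow> p \<in> S \<Longrightarrow> curlx (\<lambda>q. F q + G q) p = curlx F p + curlx G p"
  unfolding curlx_def by (simp add: deriv_within_add cross_add_right sum.distrib)

lemma curlx_scaleR:
  "smooth_upto F S \<Longrightarrow> p \<in> S \<Longrightarrow> curlx (\<lambda>q. c *\<^sub>R F q) p = c *\<^sub>R curlx F p"
  unfolding curlx_def by (simp add: deriv_within_scaleR cross_mult_right scaleR_sum_right)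

text \<open>The factors \<open>axis i 1\<close> are constant, so only \<open>D v\<close> and
  \<open>Dx i\<close> have to be interchanged. With \<open>v = (0, 1)\<close> this moves the time
  derivative inside the curl.\<close>

lemma deriv_within_curlx:
  assumes "smooth_upto F S" "p \<in> S"
  shows "D v (curlx F) p = curlx (D v F) p"
proof -
  have sm: "smooth_upto (\<lambda>q. cross3 (axis i 1) (Dx i F q)) S" for i
    by (intro smooth_upto_bounded_linear[OF bounded_linear_cross3_right] smooth_deriv_within assms)
  have "D v (\<lambda>q. cross3 (axis i 1) (Dx i F q)) p = cross3 (axis i 1) (Dx i (D v F) p)" for i
    using deriv_within_bounded_linear[OF bounded_linear_cross3_right smooth_deriv_within[OF assms(1)] assms(2)]
      deriv_within_commute[OF assms] by simp
  then show ?thesis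
    unfolding curlx_def sum_3
    by (simp add: deriv_within_add sm smooth_upto_add assms(2))
qed

text \<open>Each component is a difference of mixed second spatial derivatives of \<open>f\<close>,
  one for each of the three pairs of axes supplied to \<open>deriv_within_commute\<close>.\<close>

lemma curlx_gradx:
  assumes "smooth_upto f S" "p \<in> S"
  shows "curlx (gradx f) p = 0"
proof -
  have sm: "smooth_upto (\<lambda>q. Dx i f q *\<^sub>R axis i (1::real)) S" for i :: 3
    by (intro smooth_upto_bounded_linear[OF bounded_linear_scaleR_left] smooth_deriv_within assms)
  have "Dx k (\<lambda>q. Dx i f q *\<^sub>R axis i 1) p = Dx k (Dx i f) p *\<^sub>R (axis i 1 :: real^3)" for i k
    by (rule deriv_within_bounded_linear[OF bounded_linear_scaleR_left smooth_deriv_within[OF assms(1)] assms(2)])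
  then have "Dx k (gradx f) p = (\<Sum>i\<in>UNIV. Dx k (Dx i f) p *\<^sub>R axis i 1)" for k
    unfolding gradx_def sum_3
    by (simp add: deriv_within_add sm smooth_upto_add assms(2))
  then show ?thesis
    using deriv_within_commute[OF assms, of "(axis 1 1, 0)" "(axis 2 1, 0)"]
      deriv_within_commute[OF assms, of "(axis 1 1, 0)" "(axis 3 1, 0)"]
      deriv_within_commute[OF assms, of "(axis 2 1, 0)" "(axis 3 1, 0)"]
    by (simp add: curlx_def sum_3 cross3_def vec_eq_iff forall_3 axis_def)
qed

text \<open>The coefficients make one statement serve both vector equations:
  \<open>(a, b, c)\<close> is \<open>(- r, - c0, - ch)\<close> for \<open>J\<close>, with
  \<open>r\<close> the relaxation rate, and \<open>(0, - ch, ch)\<close> for \<open>\<psi>\<close>.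
  The term with \<open>b\<close> disappears because a curl of a gradient is zero.\<close>

lemma deriv_within_time_curlx:
  assumes sm: "smooth_upto F S" "smooth_upto f S" "smooth_upto G S"
    and ev: "\<And>q. q \<in> S \<Longrightarrow> Dt F q = a *\<^sub>R F q + (b *\<^sub>R gradx f q + c *\<^sub>R curlx G q)"
    and p: "p \<in> S"
  shows "Dt (curlx F) p = a *\<^sub>R curlx F p + c *\<^sub>R curlx (curlx G) p"
proof -
  have "Dt (curlx F) p = curlx (Dt F) p"
    using sm(1) p by (rule deriv_within_curlx)
  also have "\<dots> = curlx (\<lambda>q. a *\<^sub>R F q + (b *\<^sub>R gradx f q + c *\<^sub>R curlx G q)) p"
    using ev p by (rule curlx_cong)
  also have "\<dots> = a *\<^sub>R curlx F p + (b *\<^sub>R curlx (gradx f) p + c *\<^sub>R curlx (curlx G) p)"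
    using sm p by (simp add: curlx_add curlx_scaleR smooth_upto_add smooth_scaleR smooth_curlx smooth_gradx)
  finally show ?thesis using sm p by (simp add: curlx_gradx)
qed

lemma deriv_within_half_norms:
  assumes "smooth_upto A S" "smooth_upto B S" "p \<in> S"
  shows "D v (\<lambda>q. (A q \<bullet> A q + B q \<bullet> B q) / 2) p = A p \<bullet> D v A p + B p \<bullet> D v B p"
  using assms
  by (simp add: deriv_within_bounded_linear[OF bounded_linear_divide] deriv_within_add
      deriv_within_bilinear[OF bounded_bilinear_inner] smooth_upto_add
      bounded_bilinear.smooth_upto[OF bounded_bilinear_inner] inner_commute)

text \<open>The product rule leaves triple products with \<open>axis i 1\<close>. Cyclic rotation
  turns those containing \<open>Dx i B\<close> into \<open>A \<bullet> curlx B p\<close>; those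
  containing \<open>Dx i A\<close> acquire a minus sign from antisymmetry.\<close>

lemma divergence_cross3:
  assumes "smooth_upto A S" "smooth_upto B S" "p \<in> S"
  shows "(\<Sum>i\<in>UNIV. Dx i (\<lambda>q. c *\<^sub>R cross3 (B q) (A q)) p $ i)
    = c * (A p \<bullet> curlx B p - B p \<bullet> curlx A p)"
proof -
  have "Dx i (\<lambda>q. c *\<^sub>R cross3 (B q) (A q)) p
      = c *\<^sub>R (cross3 (B p) (Dx i A p) + cross3 (Dx i B p) (A p))" for i
    using assms by (simp add: deriv_within_scaleR bounded_bilinear.smooth_upto[OF bounded_bilinear_cross3]
        deriv_within_bilinear[OF bounded_bilinear_cross3])
  then show ?thesis
    by (simp add: curlx_def sum_3 cross3_def inner_vec_def axis_def algebra_simps)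
qed

end

subsection \<open>Integration over the cylinder\<close>

lemma set_integrable_bounded_continuous_on:
  fixes f :: "'a::euclidean_space \<Rightarrow> 'b::{banach, second_countable_topology}"
  assumes "A \<in> sets borel" "bounded A" "continuous_on A f" "bounded (f ` A)"
  shows "set_integrable lborel A f"
proof -
  obtain K where K: "\<And>x. x \<in> A \<Longrightarrow> norm (f x) \<le> K"
    using assms(4) unfolding bounded_iff by auto
  have "(\<lambda>x. indicator A x *\<^sub>R f x) \<in> borel_measurable lborel"
    using borel_measurable_continuous_on_indicator[OF assms(1,3)] by simp
  moreover have "emeasure lborel A < \<infinity>"
    using emeasure_bounded_finite[OF assms(2)] .
  \<comment> \<open>The inner indicator makes the integrand Borel measurable, as \<open>f\<close> is
    controlled only on \<open>A\<close>; the outer one gives the form of the criterion for bounded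
    functions on a set of finite measure. The duplicate is then removed by idempotence.\<close>
  ultimately have "integrable lborel (\<lambda>x. indicator A x *\<^sub>R (indicator A x *\<^sub>R f x))"
    using assms(1) K
    by (intro integrableI_bounded_set_indicator[where B = K]) auto
  moreover have "(\<lambda>x. indicator A x *\<^sub>R (indicator A x *\<^sub>R f x)) = (\<lambda>x. indicator A x *\<^sub>R f x)"
    by (auto simp: indicator_def)
  ultimately show ?thesis unfolding set_integrable_def by simp
qed

lemma set_integral_iterated_swap:
  fixes g :: "'a::euclidean_space \<times> 'b::euclidean_space \<Rightarrow> 'c::{banach, second_countable_topology}"
  assumes "set_integrable lborel (A \<times> B) g"
  shows "(LINT x:A|lborel. LINT s:B|lborel. g (x, s)) = (LINT s:B|lborel. LINT x:A|lborel. g (x, s))"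
proof -
  \<comment> \<open>The two indicators are kept as separate factors so that either one can be pulled
    out of the inner integral, whichever variable is integrated first.\<close>
  define h where "h = (\<lambda>x s. indicator A x *\<^sub>R indicator B s *\<^sub>R g (x, s))"
  have "integrable (lborel \<Otimes>\<^sub>M lborel) (case_prod h)"
    using assms unfolding set_integrable_def lborel_prod h_def
    by (simp add: indicator_times case_prod_unfold)
  from lborel_pair.Fubini_integral[OF this]
  have "(LINT s|lborel. LINT x|lborel. h x s) = (LINT x|lborel. LINT s|lborel. h x s)" .
  moreover have "(LINT s|lborel. h x s) = indicator A x *\<^sub>R (LINT s:B|lborel. g (x, s))" for x
    unfolding h_def set_lebesgue_integral_def by (simp del: scaleR_scaleR)
  moreover have "(LINT x|lborel. h x s) = indicator B s *\<^sub>R (LINT x:A|lborel. g (x, s))" for s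
    unfolding h_def set_lebesgue_integral_def
    by (subst scaleR_left_commute) (simp del: scaleR_scaleR)
  ultimately show ?thesis
    by (simp add: set_lebesgue_integral_def[of lborel B] set_lebesgue_integral_def[of lborel A])
qed

text \<open>The integral is forced to be zero, so \<open>f\<close> vanishes almost everywhere on
  \<open>A\<close>. By continuity the set where \<open>f\<close> is positive is open, and a null
  open set is empty.\<close>

lemma set_integral_nonneg_zero_imp_zero:
  fixes f :: "'a::euclidean_space \<Rightarrow> real"
  assumes "open A" "set_integrable lborel A f" "continuous_on A f"
    and "\<And>x. x \<in> A \<Longrightarrow> 0 \<le> f x" "(LINT x:A|lborel. f x) \<le> 0" "x \<in> A"
  shows "f x = 0"
proof (rule ccontr)
  assume "f x \<noteq> 0"
  define U where "U = {y \<in> A. 0 < f y}"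
  have "open U"
    using continuous_open_preimage[OF assms(3,1), of "{0<..}"]
    by (simp add: U_def vimage_def Int_def)
  have "U \<noteq> {}"
    using \<open>f x \<noteq> 0\<close> assms by (force simp: U_def)
  have "AE y in lborel. indicator A y *\<^sub>R f y = 0"
  proof (subst integral_nonneg_eq_0_iff_AE[symmetric])
    show "(LINT y|lborel. indicator A y *\<^sub>R f y) = 0"
    proof (rule antisym)
      show "0 \<le> (LINT y|lborel. indicator A y *\<^sub>R f y)"
        using assms(4) by (intro integral_nonneg_AE) (auto simp: indicator_def)
    qed (use assms(5) in \<open>simp add: set_lebesgue_integral_def\<close>)
  qed (use assms in \<open>auto simp: set_integrable_def indicator_def\<close>)
  then have "AE y in lborel. y \<notin> U"
    by eventually_elim (auto simp: U_def)
  then have "U \<in> null_sets lborel"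
    using \<open>open U\<close> by (subst AE_iff_null_sets) auto
  then have "U = {}"
    using \<open>open U\<close> open_not_negligible null_sets_completionI
    by (metis negligible_iff_null_sets)
  then show False using \<open>U \<noteq> {}\<close> by blast
qed

text \<open>Boundedness gives finite volume and a compact closure, which together make fields smooth
  up to the boundary integrable.\<close>

locale bounded_cylinder = cylinder +
  assumes bounded_base: "bounded \<Omega>"
begin

lemma smooth_continuous_on: "smooth_upto f S \<Longrightarrow> continuous_on S f"
  by (intro extends_continuously_imp_continuous_on smooth_upto_imp_extends_continuously)

lemma smooth_set_integrable:
  fixes f :: "(real^3) \<times> real \<Rightarrow> 'b::{banach, second_countable_topology}"
  assumes "smooth_upto f S" "a \<in> {0..tf}" "b \<in> {0..tf}"
  shows "set_integrable lborel (\<Omega> \<times> {a..b}) f"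
proof -
  have sub: "\<Omega> \<times> {a..b} \<subseteq> S" using assms by auto
  have bd: "bounded S" using bounded_base by (simp add: bounded_Times)
  have "bounded (f ` S)"
    by (intro extends_continuously_imp_bounded smooth_upto_imp_extends_continuously assms bd)
  then show ?thesis
    using smooth_continuous_on[OF assms(1)] sub bd open_base
    by (intro set_integrable_bounded_continuous_on borel_Times)
      (auto intro: continuous_on_subset bounded_subset)
qed

lemma smooth_slice:
  assumes "smooth_upto f S" "t \<in> {0..tf}"
  shows "Ck_upto k (\<lambda>x. f (x, t)) \<Omega>"
  using assms Ck_upto_slice unfolding smooth_upto_def by blast

lemma slice_set_integrable:
  fixes f :: "(real^3) \<times> real \<Rightarrow> 'b::{banach, second_countable_topology}"
  assumes "smooth_upto f S" "t \<in> {0..tf}"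
  shows "set_integrable lborel \<Omega> (\<lambda>x. f (x, t))"
proof -
  have "extends_continuously (\<lambda>x. f (x, t)) \<Omega>"
    using smooth_slice[OF assms] Ck_upto_imp_extends_continuously by blast
  then show ?thesis
    using open_base bounded_base
    by (intro set_integrable_bounded_continuous_on extends_continuously_imp_continuous_on
        extends_continuously_imp_bounded) auto
qed

lemma integral_time_increment:
  fixes f :: "(real^3) \<times> real \<Rightarrow> real"
  assumes f: "smooth_upto f S" and ab: "0 \<le> a" "a \<le> b" "b \<le> tf"
  shows "(LINT x:\<Omega>|lborel. f (x, b)) - (LINT x:\<Omega>|lborel. f (x, a))
    = (LINT s:{a..b}|lborel. LINT x:\<Omega>|lborel. Dt f (x, s))"
proof -
  have ftc: "(LINT s:{a..b}|lborel. Dt f (x, s)) = f (x, b) - f (x, a)" if "x \<in> \<Omega>" for x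
    unfolding set_lebesgue_integral_def
  proof (rule integral_FTC_atLeastAtMost[OF ab(2)])
    show "((\<lambda>s. f (x, s)) has_vector_derivative Dt f (x, s)) (at s within {a..b})"
      if "a \<le> s" "s \<le> b" for s
      by (rule has_vector_derivative_within_subset[OF has_vector_derivative_time[OF f \<open>x \<in> \<Omega>\<close>]])
        (use that ab in auto)
    show "continuous_on {a..b} (\<lambda>s. Dt f (x, s))"
      by (rule continuous_on_compose2[OF smooth_continuous_on[OF smooth_deriv_within[OF f]]])
        (use ab that in \<open>auto intro!: continuous_intros\<close>)
  qed
  have "(LINT x:\<Omega>|lborel. f (x, b)) - (LINT x:\<Omega>|lborel. f (x, a))
      = (LINT x:\<Omega>|lborel. f (x, b) - f (x, a))"
    using ab by (intro set_integral_diff(2)[symmetric] slice_set_integrable f) auto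
  also have "\<dots> = (LINT x:\<Omega>|lborel. LINT s:{a..b}|lborel. Dt f (x, s))"
    using open_base ftc by (intro set_lebesgue_integral_cong) auto
  \<comment> \<open>The exchange is justified since \<open>Dt f\<close> is again smooth up to the
    boundary, hence integrable over the bounded cylinder.\<close>
  also have "\<dots> = (LINT s:{a..b}|lborel. LINT x:\<Omega>|lborel. Dt f (x, s))"
    using ab by (intro set_integral_iterated_swap smooth_set_integrable smooth_deriv_within f) auto
  finally show ?thesis .
qed

end

subsection \<open>The energy balance\<close>

lemma relaxation_rate_nonneg: "0 < \<tau> \<Longrightarrow> 0 \<le> relaxation_rate \<tau>"
  unfolding relaxation_rate_def by (cases \<tau>) (auto simp: one_ereal_def)

theorem mainTheorem5:
  fixes \<Omega> :: "(real^3) set" and n :: "real^3 \<Rightarrow> real^3"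
    and c0 ch tf :: real and \<tau> :: ereal
    and T \<phi> :: "real^3 \<Rightarrow> real \<Rightarrow> real" and J \<psi> :: "real^3 \<Rightarrow> real \<Rightarrow> real^3"
  assumes "bounded_domain \<Omega>" and "divergence_theorem_holds \<Omega> n"
    and "0 < tf" and "0 < \<tau>"
    and "smooth_solution c0 ch \<tau> \<Omega> tf T J \<psi> \<phi>"
  shows "(\<forall>x\<in>\<Omega>. \<forall>t\<in>{0..tf}.
            time_deriv tf (rot_energy_density J \<psi>) x t + divergence (\<lambda>y. rot_flux ch J \<psi> y t) x
              = - (relaxation_rate \<tau> * (norm (vorticity J x t))\<^sup>2)
            \<and> - (relaxation_rate \<tau> * (norm (vorticity J x t))\<^sup>2) \<le> 0)
       \<and> ((\<forall>t\<in>{0..tf}. surface_flux \<Omega> n (\<lambda>x. rot_flux ch J \<psi> x t) = 0) \<longrightarrow>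
            (\<forall>t\<in>{0..tf}.
               rot_energy \<Omega> J \<psi> t - rot_energy \<Omega> J \<psi> 0
                 = - (relaxation_rate \<tau> *
                      (LINT s:{0..t}|lborel. (LINT x:\<Omega>|lborel. (norm (vorticity J x s))\<^sup>2)))
               \<and> - (relaxation_rate \<tau> *
                      (LINT s:{0..t}|lborel. (LINT x:\<Omega>|lborel. (norm (vorticity J x s))\<^sup>2))) \<le> 0)
            \<and> (\<tau> < \<infinity> \<longrightarrow> antimono_on {0..tf} (rot_energy \<Omega> J \<psi>))
            \<and> (\<tau> = \<infinity> \<longrightarrow> (\<forall>t\<in>{0..tf}. rot_energy \<Omega> J \<psi> t = rot_energy \<Omega> J \<psi> 0))
            \<and> ((\<forall>x\<in>\<Omega>. vorticity J x 0 = 0 \<and> vorticity \<psi> x 0 = 0) \<longrightarrow>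
                 (\<forall>x\<in>\<Omega>. \<forall>t\<in>{0<..tf}. vorticity J x t = 0 \<and> vorticity \<psi> x t = 0)))"
proof -
  interpret bounded_cylinder \<Omega> tf
    using assms(1,3) by unfold_locales (auto simp: bounded_domain_def)
  define r where "r = relaxation_rate \<tau>"
  have "0 \<le> r" using assms(4) by (simp add: r_def relaxation_rate_nonneg)
  define J' where "J' = (\<lambda>(x, t). J x t)"
  define \<psi>' where "\<psi>' = (\<lambda>(x, t). \<psi> x t)"
  define A where "A = curlx J'"
  define B where "B = curlx \<psi>'"
  define e where "e = (\<lambda>q. (A q \<bullet> A q + B q \<bullet> B q) / 2)"
  define \<Phi> where "\<Phi> = (\<lambda>q. ch *\<^sub>R cross3 (B q) (A q))"
  have sol: "smooth_upto (\<lambda>(x, t). T x t) S" "smooth_upto J' S" "smooth_upto \<psi>' S"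
    "smooth_upto (\<lambda>(x, t). \<phi> x t) S"
    using assms(5) by (auto simp: smooth_solution_def J'_def \<psi>'_def)
  have smA: "smooth_upto A S" and smB: "smooth_upto B S"
    unfolding A_def B_def by (intro smooth_curlx sol)+
  have sme: "smooth_upto e S"
    unfolding e_def
    by (intro smooth_upto_bounded_linear[OF bounded_linear_divide] smooth_upto_add
        bounded_bilinear.smooth_upto[OF bounded_bilinear_inner] smA smB)
  have sm\<Phi>: "smooth_upto \<Phi> S"
    unfolding \<Phi>_def
    by (intro smooth_scaleR bounded_bilinear.smooth_upto[OF bounded_bilinear_cross3] smA smB)
  have smAA: "smooth_upto (\<lambda>q. A q \<bullet> A q) S"
    by (intro bounded_bilinear.smooth_upto[OF bounded_bilinear_inner] smA)

  \<comment> \<open>Both vector equations are solved for the time derivative in the shape of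
    \<open>deriv_within_time_curlx\<close>; the \<open>\<psi>\<close>-equation has no damping, hence
    its coefficient \<open>0\<close>.\<close>
  have J_eq: "Dt J' q = (- r) *\<^sub>R J' q + ((- c0) *\<^sub>R gradx (\<lambda>(x, t). T x t) q + (- ch) *\<^sub>R curlx \<psi>' q)"
    and \<psi>_eq: "Dt \<psi>' q = 0 *\<^sub>R \<psi>' q + ((- ch) *\<^sub>R gradx (\<lambda>(x, t). \<phi> x t) q + ch *\<^sub>R curlx J' q)"
    if "q \<in> S" for q
  proof -
    obtain x t where q: "q = (x, t)" "x \<in> \<Omega>" "t \<in> {0..tf}" using \<open>q \<in> S\<close> by (cases q) auto
    have "time_deriv tf J x t + c0 *\<^sub>R grad (\<lambda>y. T y t) x + ch *\<^sub>R curl (\<lambda>y. \<psi> y t) x = - (r *\<^sub>R J x t)"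
      and "time_deriv tf \<psi> x t - ch *\<^sub>R curl (\<lambda>y. J y t) x + ch *\<^sub>R grad (\<lambda>y. \<phi> y t) x = 0"
      using assms(5) q by (auto simp: smooth_solution_def r_def)
    then have "Dt J' q + c0 *\<^sub>R gradx (\<lambda>(x, t). T x t) q + ch *\<^sub>R curlx \<psi>' q = - (r *\<^sub>R J' q)"
      and "Dt \<psi>' q - ch *\<^sub>R curlx J' q + ch *\<^sub>R gradx (\<lambda>(x, t). \<phi> x t) q = 0"
      using sol q by (simp_all add: time_deriv_eq grad_eq curl_eq J'_def \<psi>'_def)
    then show "Dt J' q = (- r) *\<^sub>R J' q + ((- c0) *\<^sub>R gradx (\<lambda>(x, t). T x t) q + (- ch) *\<^sub>R curlx \<psi>' q)"
      and "Dt \<psi>' q = 0 *\<^sub>R \<psi>' q + ((- ch) *\<^sub>R gradx (\<lambda>(x, t). \<phi> x t) q + ch *\<^sub>R curlx J' q)"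
      by (simp_all add: algebra_simps eq_neg_iff_add_eq_0)
  qed
  \<comment> \<open>The two curl terms combine to exactly minus the divergence of
    \<open>\<Phi>\<close> given by \<open>divergence_cross3\<close>; only the damping term is left
    over.\<close>
  have Dt_e: "Dt e q = - (r * (A q \<bullet> A q)) - ch * (A q \<bullet> curlx B q - B q \<bullet> curlx A q)" if "q \<in> S" for q
  proof -
    have dA: "Dt A q = (- r) *\<^sub>R A q + (- ch) *\<^sub>R curlx B q"
      unfolding A_def B_def by (rule deriv_within_time_curlx[OF sol(2,1,3) J_eq that])
    have dB: "Dt B q = 0 *\<^sub>R B q + ch *\<^sub>R curlx A q"
      unfolding A_def B_def by (rule deriv_within_time_curlx[OF sol(3,4,2) \<psi>_eq that])
    show ?thesis
      unfolding e_def deriv_within_half_norms[OF smA smB that] dA dB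
      by (simp add: inner_add_right inner_diff_right right_diff_distrib)
  qed

  have vort: "vorticity J x t = A (x, t)" "vorticity \<psi> x t = B (x, t)" if "x \<in> \<Omega>" "t \<in> {0..tf}" for x t
    using sol that by (simp_all add: vorticity_def curl_eq A_def B_def J'_def \<psi>'_def)
  have density: "rot_energy_density J \<psi> x t = e (x, t)" if "x \<in> \<Omega>" "t \<in> {0..tf}" for x t
    using vort[OF that] by (simp add: rot_energy_density_def e_def power2_norm_eq_inner)
  have flux: "rot_flux ch J \<psi> x t = \<Phi> (x, t)" if "x \<in> \<Omega>" "t \<in> {0..tf}" for x t
    using vort[OF that] by (simp add: rot_flux_def \<Phi>_def)
  \<comment> \<open>The original fields agree with \<open>e\<close> and \<open>\<Phi>\<close> only
    on the cylinder, so smoothness is transferred by congruence on \<open>S\<close>.\<close>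
  have sm_density: "smooth_upto (\<lambda>(x, t). rot_energy_density J \<psi> x t) S"
    using sme smooth_upto_cong[of S "\<lambda>(x, t). rot_energy_density J \<psi> x t" e] density by auto
  have sm_flux: "smooth_upto (\<lambda>(x, t). rot_flux ch J \<psi> x t) S"
    using sm\<Phi> smooth_upto_cong[of S "\<lambda>(x, t). rot_flux ch J \<psi> x t" \<Phi>] flux by auto

  have div: "divergence (\<lambda>y. rot_flux ch J \<psi> y t) x
      = ch * (A (x, t) \<bullet> curlx B (x, t) - B (x, t) \<bullet> curlx A (x, t))" if "x \<in> \<Omega>" "t \<in> {0..tf}" for x t
  proof -
    have "Dx i (\<lambda>(x, t). rot_flux ch J \<psi> x t) (x, t) = Dx i \<Phi> (x, t)" for i
      using flux that by (intro deriv_within_cong) auto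
    then show ?thesis
      unfolding divergence_def partial_eq[OF sm_flux that]
      using divergence_cross3[OF smA smB, of "(x, t)" ch] that by (simp add: \<Phi>_def)
  qed
  have balance: "time_deriv tf (rot_energy_density J \<psi>) x t + divergence (\<lambda>y. rot_flux ch J \<psi> y t) x
      = - (r * (norm (vorticity J x t))\<^sup>2)" if "x \<in> \<Omega>" "t \<in> {0..tf}" for x t
  proof -
    have "Dt (\<lambda>(x, t). rot_energy_density J \<psi> x t) (x, t) = Dt e (x, t)"
      using density that by (intro deriv_within_cong) auto
    then show ?thesis
      using time_deriv_eq[OF sm_density that] div[OF that] Dt_e[of "(x, t)"] vort[OF that] that
      by (simp add: power2_norm_eq_inner)
  qed

  have energy: "rot_energy \<Omega> J \<psi> t = (LINT x:\<Omega>|lborel. e (x, t))" if "t \<in> {0..tf}" for t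
    unfolding rot_energy_def using density that open_base by (intro set_lebesgue_integral_cong) auto
  have dissipation: "(LINT x:\<Omega>|lborel. (norm (vorticity J x t))\<^sup>2) = (LINT x:\<Omega>|lborel. A (x, t) \<bullet> A (x, t))"
    if "t \<in> {0..tf}" for t
    using vort that open_base
    by (intro set_lebesgue_integral_cong) (auto simp: power2_norm_eq_inner)

  \<comment> \<open>The initial time \<open>a\<close> is arbitrary because monotonicity compares any
    two times; the balance from time zero and the conservation law are the case
    \<open>a = 0\<close>.\<close>
  have integrated: "rot_energy \<Omega> J \<psi> b - rot_energy \<Omega> J \<psi> a
        = - (r * (LINT s:{a..b}|lborel. LINT x:\<Omega>|lborel. (norm (vorticity J x s))\<^sup>2))"
      and dissipated: "0 \<le> r * (LINT s:{a..b}|lborel. LINT x:\<Omega>|lborel. (norm (vorticity J x s))\<^sup>2)"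
    if bc: "\<forall>t\<in>{0..tf}. surface_flux \<Omega> n (\<lambda>x. rot_flux ch J \<psi> x t) = 0"
      and ab: "0 \<le> a" "a \<le> b" "b \<le> tf" for a b
  proof -
    have rate: "(LINT x:\<Omega>|lborel. Dt e (x, s)) = - r * (LINT x:\<Omega>|lborel. (norm (vorticity J x s))\<^sup>2)"
      if s: "s \<in> {0..tf}" for s
    proof -
      \<comment> \<open>A time slice of the flux is continuously differentiable up to the boundary,
        so the divergence theorem applies and the boundary condition makes this integral
        zero.\<close>
      have flux0: "(LINT x:\<Omega>|lborel. divergence (\<lambda>y. rot_flux ch J \<psi> y s) x) = 0"
        using assms(2) bc s smooth_slice[OF sm_flux s, of 1]
        unfolding divergence_theorem_holds_def by simp
      have "(LINT x:\<Omega>|lborel. divergence (\<lambda>y. rot_flux ch J \<psi> y s) x)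
          = (LINT x:\<Omega>|lborel. - r * (A (x, s) \<bullet> A (x, s)) - Dt e (x, s))"
        using div[OF _ s] Dt_e s open_base by (intro set_lebesgue_integral_cong) auto
      also have "\<dots> = - r * (LINT x:\<Omega>|lborel. A (x, s) \<bullet> A (x, s)) - (LINT x:\<Omega>|lborel. Dt e (x, s))"
        using slice_set_integrable[OF smAA s] slice_set_integrable[OF smooth_deriv_within[OF sme] s]
        by (simp only: set_integral_diff(2) set_integrable_mult_right set_integral_mult_right)
      finally show ?thesis using flux0 dissipation[OF s] by simp
    qed
    have "rot_energy \<Omega> J \<psi> b - rot_energy \<Omega> J \<psi> a = (LINT s:{a..b}|lborel. LINT x:\<Omega>|lborel. Dt e (x, s))"
      using integral_time_increment[OF sme ab] energy ab by simp
    also have "\<dots> = (LINT s:{a..b}|lborel. - r * (LINT x:\<Omega>|lborel. (norm (vorticity J x s))\<^sup>2))"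
      using rate ab by (intro set_lebesgue_integral_cong) auto
    finally show "rot_energy \<Omega> J \<psi> b - rot_energy \<Omega> J \<psi> a
        = - (r * (LINT s:{a..b}|lborel. LINT x:\<Omega>|lborel. (norm (vorticity J x s))\<^sup>2))"
      by (simp only: set_integral_mult_right)
    \<comment> \<open>The integral of a nonnegative function is nonnegative, the default value
      \<open>0\<close> for a non-integrable one included.\<close>
    show "0 \<le> r * (LINT s:{a..b}|lborel. LINT x:\<Omega>|lborel. (norm (vorticity J x s))\<^sup>2)"
      using \<open>0 \<le> r\<close> unfolding set_lebesgue_integral_def
      by (intro mult_nonneg_nonneg integral_nonneg_AE) (auto intro!: integral_nonneg_AE)
  qed

  have involution: "A (x, t) = 0 \<and> B (x, t) = 0"
    if bc: "\<forall>t\<in>{0..tf}. surface_flux \<Omega> n (\<lambda>x. rot_flux ch J \<psi> x t) = 0"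
      and init: "\<forall>x\<in>\<Omega>. vorticity J x 0 = 0 \<and> vorticity \<psi> x 0 = 0"
      and x: "x \<in> \<Omega>" and t: "t \<in> {0..tf}" for x t
  proof -
    \<comment> \<open>The energy starts at zero and cannot grow, yet its density is nonnegative and
      continuous, so the density vanishes throughout \<open>\<Omega>\<close>. Being half a sum of
      two squares, it forces both curls to be zero.\<close>
    have "rot_energy \<Omega> J \<psi> 0 = (LINT x:\<Omega>|lborel. 0)"
      unfolding rot_energy_def rot_energy_density_def
      using init open_base by (intro set_lebesgue_integral_cong) auto
    then have "rot_energy \<Omega> J \<psi> t \<le> 0"
      using integrated[OF bc, of 0 t] dissipated[OF bc, of 0 t] t by (simp add: set_lebesgue_integral_def)
    then have "e (x, t) = 0"
      using slice_set_integrable[OF sme t] energy[OF t] open_base x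
        extends_continuously_imp_continuous_on[OF Ck_upto_imp_extends_continuously[OF smooth_slice[OF sme t]]]
      by (intro set_integral_nonneg_zero_imp_zero[of \<Omega> "\<lambda>x. e (x, t)"]) (auto simp: e_def)
    then show ?thesis
      by (simp add: e_def add_nonneg_eq_0_iff)
  qed

  show ?thesis
  proof (intro conjI impI ballI)
    fix x t assume xt: "x \<in> \<Omega>" "t \<in> {0..tf}"
    show "time_deriv tf (rot_energy_density J \<psi>) x t + divergence (\<lambda>y. rot_flux ch J \<psi> y t) x
        = - (relaxation_rate \<tau> * (norm (vorticity J x t))\<^sup>2)"
      using balance[OF xt] by (simp add: r_def)
    show "- (relaxation_rate \<tau> * (norm (vorticity J x t))\<^sup>2) \<le> 0"
      using \<open>0 \<le> r\<close> by (simp add: r_def)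
  next
    assume bc: "\<forall>t\<in>{0..tf}. surface_flux \<Omega> n (\<lambda>x. rot_flux ch J \<psi> x t) = 0"
    fix t assume t: "t \<in> {0..tf}"
    show "rot_energy \<Omega> J \<psi> t - rot_energy \<Omega> J \<psi> 0 = - (relaxation_rate \<tau> *
        (LINT s:{0..t}|lborel. LINT x:\<Omega>|lborel. (norm (vorticity J x s))\<^sup>2))"
      and "- (relaxation_rate \<tau> *
        (LINT s:{0..t}|lborel. LINT x:\<Omega>|lborel. (norm (vorticity J x s))\<^sup>2)) \<le> 0"
      using integrated[OF bc, of 0 t] dissipated[OF bc, of 0 t] t by (auto simp: r_def)
  next
    assume bc: "\<forall>t\<in>{0..tf}. surface_flux \<Omega> n (\<lambda>x. rot_flux ch J \<psi> x t) = 0"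
    show "antimono_on {0..tf} (rot_energy \<Omega> J \<psi>)"
    proof (rule monotone_onI)
      fix a b assume "a \<in> {0..tf}" "b \<in> {0..tf}" "a \<le> b"
      then show "rot_energy \<Omega> J \<psi> b \<le> rot_energy \<Omega> J \<psi> a"
        using integrated[OF bc, of a b] dissipated[OF bc, of a b] by auto
    qed
  next
    assume bc: "\<forall>t\<in>{0..tf}. surface_flux \<Omega> n (\<lambda>x. rot_flux ch J \<psi> x t) = 0"
    assume "\<tau> = \<infinity>"
    then have "r = 0" by (simp add: r_def relaxation_rate_def)
    fix t assume "t \<in> {0..tf}"
    then show "rot_energy \<Omega> J \<psi> t = rot_energy \<Omega> J \<psi> 0"
      using integrated[OF bc, of 0 t] \<open>r = 0\<close> by auto
  next
    assume bc: "\<forall>t\<in>{0..tf}. surface_flux \<Omega> n (\<lambda>x. rot_flux ch J \<psi> x t) = 0"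
      and init: "\<forall>x\<in>\<Omega>. vorticity J x 0 = 0 \<and> vorticity \<psi> x 0 = 0"
    fix x t assume "x \<in> \<Omega>" "t \<in> {0<..tf}"
    then show "vorticity J x t = 0" and "vorticity \<psi> x t = 0"
      using involution[OF bc init, of x t] vort[of x t] by auto
  qed
qed

end
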